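(* Consider the RBCD method with noisy data for solving $\sum_{i=1}^bv_{li}Kx_i=y_l$, $l=1,\dots,d$. Assume that $V=(v_{li})$ has full column rank and let $v^*:=\max\{\|v_i\|^2:i=1,\dots,b\}$, where $v_i$ is the $i$-th column of $V$. Assume $0<\gamma<2/(v^*\|K\|^2)$ and let $x^\dagger$ denote the unique $x_0$-minimum-norm solution of the system. If the (deterministic) integer $k_\delta$ is chosen such that $k_\delta\to\infty$ and $\delta^2k_\delta\to0$ as $\delta\to0$, then $\mathbb E[\|x_{k_\delta}^\delta-x^\dagger\|^2]\to0$ as $\delta\to0$.
   Context: Let $X,Y$ be real Hilbert spaces, $K:X\to Y$ a bounded linear operator, and $V=(v_{li})$ a real $d\times b$ matrix. Define $A:X^b\to Y^d$ by $Ax:=\big(\sum_{i=1}^bv_{li}Kx_i\big)_{l=1}^d$ and $A_i:X\to Y^d$ by $A_iz:=(v_{li}Kz)_{l=1}^d$, so that $Ax=\sum_{i=1}^bA_ix_i$ and $A_i^*\tilde y=\sum_{l=1}^dv_{li}K^*\tilde y_l$; $X^b$ and $Y^d$ carry the product inner products. The system reads $Ax=y$ with $y=(y_1,\dots,y_d)\in Y^d$, and it is assumed that $y\in\mathrm{Ran}(A)$. For each noise level $\delta>0$, $y^\delta\in Y^d$ is noisy data with $\|y^\delta-y\|\le\delta$. RBCD method with noisy data: let $i_0,i_1,\dots$ be independent random indices, each uniformly distributed on $\{1,\dots,b\}$. Starting from $x_0^\delta:=x_0\in X^b$, with step size $\gamma>0$, for $k\ge0$ set $x^\delta_{k+1,i}=x^\delta_{k,i}$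 for $i\ne i_k$ and $x^\delta_{k+1,i_k}=x^\delta_{k,i_k}-\gamma A_{i_k}^*(Ax^\delta_k-y^\delta)$. The $x_0$-minimum-norm solution is the solution $x$ of $Ax=y$ minimizing $\|x-x_0\|$. $\mathbb E$ denotes expectation with respect to the random indices; $\|v_i\|$ is the Euclidean norm. *)

theory Defs
  imports "HOL-Probability.Probability"
begin

text \<open>The product spaces X^b and Y^d are \<open>'x ^ 'b\<close> and \<open>'y ^ 'd\<close>, whose library inner
  product is the sum of the componentwise ones.\<close>

definition system_op ::
  "('x::real_inner \<Rightarrow> 'y::real_inner) \<Rightarrow> real ^ 'b ^ 'd \<Rightarrow> 'x ^ 'b \<Rightarrow> 'y ^ 'd" where
  "system_op K V x = (\<chi> l. \<Sum>i\<in>UNIV. (V $ l $ i) *\<^sub>R K (x $ i))"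

definition block_op ::
  "('x::real_inner \<Rightarrow> 'y::real_inner) \<Rightarrow> real ^ 'b ^ 'd \<Rightarrow> 'b \<Rightarrow> 'x \<Rightarrow> 'y ^ 'd" where
  "block_op K V i z = (\<chi> l. (V $ l $ i) *\<^sub>R K z)"

primrec rbcd ::
  "('x::real_inner \<Rightarrow> 'y::real_inner) \<Rightarrow> real ^ 'b ^ 'd \<Rightarrow> real \<Rightarrow> 'y ^ 'd \<Rightarrow> 'x ^ 'b
     \<Rightarrow> (nat \<Rightarrow> 'b) \<Rightarrow> nat \<Rightarrow> 'x ^ 'b" where
  "rbcd K V \<gamma> y x0 idx 0 = x0"
| "rbcd K V \<gamma> y x0 idx (Suc k) =
     (let x = rbcd K V \<gamma> y x0 idx k in
      \<chi> j. if j = idx k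
          then x $ j - \<gamma> *\<^sub>R adjoint (block_op K V j) (system_op K V x - y)
          else x $ j)"

definition is_min_norm_solution ::
  "('x::real_inner \<Rightarrow> 'y::real_inner) \<Rightarrow> real ^ 'b ^ 'd \<Rightarrow> 'y ^ 'd \<Rightarrow> 'x ^ 'b \<Rightarrow> 'x ^ 'b \<Rightarrow> bool" where
  "is_min_norm_solution K V y x0 x \<longleftrightarrow>
     system_op K V x = y \<and> (\<forall>z. system_op K V z = y \<longrightarrow> norm (x - x0) \<le> norm (z - x0))"

definition min_norm_solution ::
  "('x::real_inner \<Rightarrow> 'y::real_inner) \<Rightarrow> real ^ 'b ^ 'd \<Rightarrow> 'y ^ 'd \<Rightarrow> 'x ^ 'b \<Rightarrow> 'x ^ 'b" where
  "min_norm_solution K V y x0 = (THE x. is_min_norm_solution K V y x0 x)"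

definition max_col_sq :: "real ^ 'b ^ 'd \<Rightarrow> real" where
  "max_col_sq V = Max (range (\<lambda>i. (norm (column i V))\<^sup>2))"

definition iid_uniform_indices :: "'w measure \<Rightarrow> (nat \<Rightarrow> 'w \<Rightarrow> 'b::finite) \<Rightarrow> bool" where
  "iid_uniform_indices M I \<longleftrightarrow>
     prob_space.indep_vars M (\<lambda>_. count_space UNIV) I UNIV \<and>
     (\<forall>k. distr M (count_space UNIV) (I k) = uniform_count_measure UNIV)"

end

theory Submission
  imports Defs
begin

text \<open>
  Since the iteration is affine, the error of the noisy iterates splits into the noise-free
  iteration for zero data started at \<open>x\<^sub>0 - x\<^sup>\<dagger>\<close> and the iteration for the data error \<open>\<eta>\<close> started
  at 0. The Lyapunov function \<open>\<parallel>x\<parallel>\<^sup>2 + c \<parallel>Ax - \<eta>\<parallel>\<^sup>2\<close>, for a suitable \<open>c\<close>, grows in expectation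
  by at most \<open>\<gamma>/b (\<parallel>\<eta>\<parallel>\<^sup>2 - \<parallel>Ax - \<eta>\<parallel>\<^sup>2)\<close> per step. Hence the noise part is of order \<open>k\<delta>\<^sup>2\<close>, while
  in the noise-free part the expected squared residuals are summable and the iteration is uniformly
  bounded in mean square. The blockwise operator \<open>K\<^sup>*K\<close> commutes with the noise-free iteration and,
  by full column rank, is dominated by \<open>A\<close>, so starting points in its range give errors tending to
  0; they are dense in the orthogonal complement of the kernel of \<open>A\<close>, which contains \<open>x\<^sub>0 - x\<^sup>\<dagger>\<close>.
\<close>

subsection \<open>Hilbert space preliminaries\<close>

lemma parallelogram_law:
  fixes x y :: "'a::real_inner"
  shows "(norm (x + y))\<^sup>2 + (norm (x - y))\<^sup>2 = 2 * (norm x)\<^sup>2 + 2 * (norm y)\<^sup>2"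
  by (simp add: power2_norm_eq_inner inner_simps inner_commute)

lemma norm_add_square_le:
  fixes x y :: "'a::real_inner"
  shows "(norm (x + y))\<^sup>2 \<le> 2 * (norm x)\<^sup>2 + 2 * (norm y)\<^sup>2"
  using parallelogram_law[of x y] zero_le_power2[of "norm (x - y)"] by linarith

text \<open>A minimizing sequence is Cauchy by the parallelogram law: midpoints of its members stay
  in the convex set \<open>S\<close>, so their squared distance to \<open>a\<close> cannot fall
  below the infimum \<open>m\<close>.\<close>

lemma exists_closest_point:
  fixes S :: "'a::{real_inner, complete_space} set"
  assumes "closed S" "convex S" "S \<noteq> {}"
  obtains p where "p \<in> S" "\<And>z. z \<in> S \<Longrightarrow> norm (p - a) \<le> norm (z - a)"
proof -
  define m where "m = Inf ((\<lambda>z. (norm (z - a))\<^sup>2) ` S)"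
  have bdd: "bdd_below ((\<lambda>z. (norm (z - a))\<^sup>2) ` S)"
    by (rule bdd_belowI[of _ 0]) auto
  have lower: "m \<le> (norm (z - a))\<^sup>2" if "z \<in> S" for z
    unfolding m_def by (rule cInf_lower) (use that bdd in auto)
  have "\<exists>z\<in>S. (norm (z - a))\<^sup>2 < m + inverse (real (Suc n))" for n
  proof -
    have "m < m + inverse (real (Suc n))" by simp
    then show ?thesis
      using cInf_lessD[of "(\<lambda>z. (norm (z - a))\<^sup>2) ` S" "m + inverse (real (Suc n))"] assms(3)
      unfolding m_def by blast
  qed
  then obtain s where s: "\<And>n. s n \<in> S"
    and sm: "\<And>n. (norm (s n - a))\<^sup>2 < m + inverse (real (Suc n))"
    by metis
  have close: "(norm (s i - s j))\<^sup>2 \<le> 2 * inverse (real (Suc i)) + 2 * inverse (real (Suc j))" for i j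
  proof -
    have mid: "(1/2) *\<^sub>R s i + (1/2) *\<^sub>R s j \<in> S"
      by (rule convexD[OF assms(2)]) (use s in auto)
    have "(s i - a) + (s j - a) = 2 *\<^sub>R (((1/2) *\<^sub>R s i + (1/2) *\<^sub>R s j) - a)"
      by (simp add: algebra_simps scaleR_2)
    then have "(norm ((s i - a) + (s j - a)))\<^sup>2
        = 4 * (norm (((1/2) *\<^sub>R s i + (1/2) *\<^sub>R s j) - a))\<^sup>2"
      by (simp add: power_mult_distrib)
    then have "4 * m \<le> (norm ((s i - a) + (s j - a)))\<^sup>2"
      using lower[OF mid] by simp
    then show ?thesis
      using parallelogram_law[of "s i - a" "s j - a"] sm[of i] sm[of j] by simp
  qed
  have "Cauchy s"
  proof (rule metric_CauchyI)
    fix e :: real assume "e > 0"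
    then obtain N where N: "inverse (real (Suc N)) < e\<^sup>2 / 4"
      using reals_Archimedean[of "e\<^sup>2 / 4"] by auto
    show "\<exists>M. \<forall>i\<ge>M. \<forall>j\<ge>M. dist (s i) (s j) < e"
    proof (intro exI[of _ N] allI impI)
      fix i j assume "N \<le> i" "N \<le> j"
      then have "inverse (real (Suc i)) \<le> inverse (real (Suc N))"
        "inverse (real (Suc j)) \<le> inverse (real (Suc N))"
        by (auto intro!: le_imp_inverse_le)
      then have "(norm (s i - s j))\<^sup>2 < e\<^sup>2"
        using close[of i j] N by linarith
      then show "dist (s i) (s j) < e"
        unfolding dist_norm by (rule power_less_imp_less_base) (use \<open>e > 0\<close> in simp)
    qed
  qed
  then obtain p where p: "s \<longlonglongrightarrow> p"
    using Cauchy_convergent convergent_def by blast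
  have "p \<in> S"
    using assms(1) s p closed_sequentially by blast
  have "(\<lambda>n. (norm (s n - a))\<^sup>2) \<longlonglongrightarrow> (norm (p - a))\<^sup>2"
    by (intro tendsto_intros p)
  moreover have "(\<lambda>n. m + inverse (real (Suc n))) \<longlonglongrightarrow> m + 0"
    by (intro tendsto_intros LIMSEQ_inverse_real_of_nat)
  ultimately have "(norm (p - a))\<^sup>2 \<le> m + 0"
    by (rule LIMSEQ_le) (use sm less_imp_le in blast)
  then have "norm (p - a) \<le> norm (z - a)" if "z \<in> S" for z
    using lower[OF that] by (intro power2_le_imp_le[of "norm (p - a)"] norm_ge_zero) linarith
  with \<open>p \<in> S\<close> that show ?thesis by blast
qed

lemma closest_point_orthogonal:
  fixes p a n :: "'a::real_inner"
  assumes "\<And>t::real. norm (p - a) \<le> norm (p + t *\<^sub>R n - a)"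
  shows "(p - a) \<bullet> n = 0"
proof (cases "n = 0")
  case False
  \<comment> \<open>The minimizer in \<open>t\<close> of the quadratic expanded below.\<close>
  define t where "t = - ((p - a) \<bullet> n) / (n \<bullet> n)"
  have "(norm (p - a))\<^sup>2 \<le> (norm ((p - a) + t *\<^sub>R n))\<^sup>2"
    using assms[of t] by (intro power_mono) (auto simp: algebra_simps)
  also have "\<dots> = (norm (p - a))\<^sup>2 + 2 * t * ((p - a) \<bullet> n) + t\<^sup>2 * (n \<bullet> n)"
    unfolding power2_norm_eq_inner
    by (simp add: inner_add_left inner_add_right inner_commute power2_eq_square
          del: inner_diff_left inner_diff_right)
  also have "\<dots> = (norm (p - a))\<^sup>2 - ((p - a) \<bullet> n)\<^sup>2 / (n \<bullet> n)"
    using False unfolding t_def by (simp add: power2_eq_square field_simps)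
  finally have "((p - a) \<bullet> n)\<^sup>2 / (n \<bullet> n) \<le> 0" by simp
  then show ?thesis
    using False inner_gt_zero_iff[of n] by (simp add: divide_le_0_iff del: inner_gt_zero_iff)
qed simp

lemma exists_orthogonal_projection:
  fixes S :: "'a::{real_inner, complete_space} set"
  assumes "closed S" "subspace S"
  obtains p where "p \<in> S" "\<And>z. z \<in> S \<Longrightarrow> (p - a) \<bullet> z = 0"
proof -
  obtain p where p: "p \<in> S" "\<And>z. z \<in> S \<Longrightarrow> norm (p - a) \<le> norm (z - a)"
    using exists_closest_point[of S a] assms subspace_imp_convex subspace_0 by blast
  have "(p - a) \<bullet> z = 0" if "z \<in> S" for z
    by (rule closest_point_orthogonal)
      (use p that assms in \<open>auto intro!: p(2) subspace_add subspace_scale\<close>)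
  with p that show ?thesis by blast
qed

text \<open>The kernel of a nonzero \<open>f\<close> is a closed hyperplane. Projecting a point off
  the kernel onto it yields a normal direction \<open>n\<close>, and rescaling \<open>n\<close>
  gives the representing vector.\<close>

lemma Riesz_representation:
  fixes f :: "'a::{real_inner, complete_space} \<Rightarrow> real"
  assumes "bounded_linear f"
  obtains u where "\<And>x. f x = x \<bullet> u"
proof (cases "\<forall>x. f x = 0")
  case True
  then show ?thesis using that[of 0] by simp
next
  case False
  then obtain a where a: "f a \<noteq> 0" by blast
  interpret f: bounded_linear f by fact
  define S where "S = {x. f x = 0}"
  have "closed S"
    unfolding S_def
    by (intro closed_Collect_eq continuous_on_const linear_continuous_on assms)
  moreover have "subspace S"
    unfolding S_def by (auto simp: subspace_def f.add f.scaleR f.zero)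
  ultimately obtain p where p: "p \<in> S" "\<And>z. z \<in> S \<Longrightarrow> (p - a) \<bullet> z = 0"
    using exists_orthogonal_projection by blast
  define n where "n = p - a"
  have fn: "f n = - f a" using p(1) by (simp add: n_def S_def f.diff)
  then have "n \<noteq> 0" using a f.zero by auto
  have "f x = x \<bullet> ((f n / (n \<bullet> n)) *\<^sub>R n)" for x
  proof -
    have "x - (f x / f n) *\<^sub>R n \<in> S"
      unfolding S_def mem_Collect_eq f.diff f.scaleR using fn a by simp
    then have "n \<bullet> (x - (f x / f n) *\<^sub>R n) = 0"
      using p(2) n_def by blast
    then have "n \<bullet> x = (f x / f n) * (n \<bullet> n)"
      by (simp add: inner_diff_right)
    then show ?thesis using \<open>n \<noteq> 0\<close> fn a by (simp add: inner_commute)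
  qed
  then show ?thesis using that by blast
qed

text \<open>\<open>adjoint\<close> is defined by choice, so its defining identity holds once some
  function satisfying it is exhibited; Riesz representation supplies the value of such a function at
  each \<open>y\<close>.\<close>

lemma adjoint_inner:
  fixes f :: "'a::{real_inner, complete_space} \<Rightarrow> 'b::real_inner"
  assumes "bounded_linear f"
  shows "f x \<bullet> y = x \<bullet> adjoint f y"
proof -
  have "\<exists>u. \<forall>x. f x \<bullet> y = x \<bullet> u" for y
    using Riesz_representation[of "\<lambda>x. f x \<bullet> y"]
      bounded_linear_compose[OF bounded_linear_inner_left assms]
    by (metis (mono_tags, lifting))
  then obtain g where "\<forall>x y. f x \<bullet> y = x \<bullet> g y" by metis
  moreover from this have "adjoint f = g" by (rule adjoint_unique)
  ultimately show ?thesis by simp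
qed

lemma bounded_linear_adjoint:
  fixes f :: "'a::{real_inner, complete_space} \<Rightarrow> 'b::real_inner"
  assumes "bounded_linear f"
  shows "bounded_linear (adjoint f)"
proof (rule bounded_linear_intro[where K = "onorm f"])
  note adj = adjoint_inner[OF assms]
  show "adjoint f (x + y) = adjoint f x + adjoint f y" for x y
    by (rule vector_eq_ldot[THEN iffD1])
      (simp add: inner_add_right adj[symmetric])
  show "adjoint f (r *\<^sub>R x) = r *\<^sub>R adjoint f x" for r x
    by (rule vector_eq_ldot[THEN iffD1])
      (simp add: adj[symmetric])
  show "norm (adjoint f x) \<le> norm x * onorm f" for x
  proof (cases "adjoint f x = 0")
    case False
    have "(norm (adjoint f x))\<^sup>2 = f (adjoint f x) \<bullet> x"
      by (simp add: adj power2_norm_eq_inner)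
    also have "\<dots> \<le> norm (f (adjoint f x)) * norm x"
      by (rule norm_cauchy_schwarz)
    also have "\<dots> \<le> onorm f * norm (adjoint f x) * norm x"
      by (intro mult_right_mono onorm[OF assms]) simp
    finally show ?thesis
      using False by (simp add: power2_eq_square mult.commute mult.left_commute)
  qed (simp add: onorm_pos_le[OF assms])
qed

section \<open>Closure of the range of a self-adjoint operator\<close>

lemma subspace_closure:
  fixes S :: "'a::real_normed_vector set"
  assumes "subspace S"
  shows "subspace (closure S)"
  unfolding subspace_def
proof (intro conjI ballI allI)
  show "0 \<in> closure S"
    using closure_subset subspace_0[OF assms] by blast
  fix x assume x: "x \<in> closure S"
  then obtain f where f: "\<And>n. f n \<in> S" "f \<longlonglongrightarrow> x"
    by (auto simp: closure_sequential)
  show "c *\<^sub>R x \<in> closure S" for c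
    unfolding closure_sequential
    by (intro exI[of _ "\<lambda>n. c *\<^sub>R f n"] conjI allI subspace_scale assms tendsto_scaleR tendsto_const f)
  fix y assume "y \<in> closure S"
  then obtain g where g: "\<And>n. g n \<in> S" "g \<longlonglongrightarrow> y"
    by (auto simp: closure_sequential)
  show "x + y \<in> closure S"
    unfolding closure_sequential
    by (intro exI[of _ "\<lambda>n. f n + g n"] conjI allI subspace_add assms tendsto_add f g)
qed

text \<open>Let \<open>p\<close> be the projection of \<open>e\<close> onto the closed range. Then
  \<open>p - e\<close> is orthogonal to the range, hence in the kernel of \<open>T\<close> by
  self-adjointness, hence orthogonal to \<open>e\<close>. Being orthogonal to \<open>p\<close> as
  well, it vanishes.\<close>

lemma closure_range_self_adjoint:
  fixes T :: "'a::{real_inner, complete_space} \<Rightarrow> 'a"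
  assumes "bounded_linear T" and self: "\<And>x y. T x \<bullet> y = x \<bullet> T y"
    and orth: "\<And>n. T n = 0 \<Longrightarrow> e \<bullet> n = 0"
  shows "e \<in> closure (range T)"
proof -
  interpret T: bounded_linear T by fact
  have "subspace (closure (range T))"
    by (intro subspace_closure linear_subspace_image T.linear_axioms subspace_UNIV)
  then obtain p where p: "p \<in> closure (range T)"
    "\<And>z. z \<in> closure (range T) \<Longrightarrow> (p - e) \<bullet> z = 0"
    using exists_orthogonal_projection[of "closure (range T)" e] by auto
  have "T (p - e) \<bullet> T (p - e) = 0"
    unfolding self[of "p - e"] using p(2) closure_subset[of "range T"] by blast
  then have "T (p - e) = 0" by simp
  then have "e \<bullet> (p - e) = 0" by (rule orth)
  moreover have "(p - e) \<bullet> p = 0" by (rule p(2)[OF p(1)])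
  ultimately have "(p - e) \<bullet> (p - e) = 0"
    by (simp add: inner_diff_right inner_commute)
  then show ?thesis using p(1) by simp
qed

lemma bounded_linear_vec_lambda:
  fixes f :: "'i::finite \<Rightarrow> 'a::real_normed_vector \<Rightarrow> 'b::real_normed_vector"
  assumes "\<And>i. bounded_linear (f i)"
  shows "bounded_linear (\<lambda>x. \<chi> i. f i x)"
proof (rule bounded_linear_intro[where K = "\<Sum>i\<in>UNIV. onorm (f i)"])
  show "(\<chi> i. f i (x + y)) = (\<chi> i. f i x) + (\<chi> i. f i y)" for x y
    using assms by (simp add: vec_eq_iff linear_simps)
  show "(\<chi> i. f i (r *\<^sub>R x)) = r *\<^sub>R (\<chi> i. f i x)" for r x
    using assms by (simp add: vec_eq_iff linear_simps)
  show "norm (\<chi> i. f i x) \<le> norm x * (\<Sum>i\<in>UNIV. onorm (f i))" for x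
  proof -
    have "norm (\<chi> i. f i x) \<le> (\<Sum>i\<in>UNIV. norm (f i x))"
      unfolding norm_vec_def by (rule order_trans[OF L2_set_le_sum]) auto
    also have "\<dots> \<le> (\<Sum>i\<in>UNIV. onorm (f i) * norm x)"
      by (intro sum_mono onorm assms)
    finally show ?thesis by (simp add: sum_distrib_left mult.commute)
  qed
qed

subsection \<open>Averaging over the last random index\<close>

text \<open>The product space has finitely many points, each of them a measurable box, so its
  sigma-algebra is discrete.\<close>

lemma measurable_PiM_count_space_finite:
  fixes F :: "('i \<Rightarrow> 'b::finite) \<Rightarrow> 'c"
  assumes "finite A" and "F \<in> PiE A (\<lambda>_. UNIV) \<rightarrow> space N"
  shows "F \<in> measurable (PiM A (\<lambda>_. count_space UNIV)) N"
proof (rule measurableI)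
  have fin: "finite (PiE A (\<lambda>_. UNIV :: 'b set))"
    using assms(1) by (intro finite_PiE) auto
  have single: "{x} \<in> sets (PiM A (\<lambda>_. count_space (UNIV :: 'b set)))"
    if "x \<in> PiE A (\<lambda>_. UNIV)" for x
  proof -
    have "{x} = PiE A (\<lambda>i. {x i})"
      using that by (simp add: PiE_singleton PiE_iff)
    also have "\<dots> \<in> sets (PiM A (\<lambda>_. count_space UNIV))"
      by (intro sets_PiM_I_finite assms) auto
    finally show ?thesis .
  qed
  show "F x \<in> space N" if "x \<in> space (PiM A (\<lambda>_. count_space UNIV))" for x
    using that assms(2) by (auto simp: space_PiM)
  fix B :: "'c set"
  let ?S = "F -` B \<inter> space (PiM A (\<lambda>_. count_space (UNIV :: 'b set)))"
  have "?S = (\<Union>x\<in>?S. {x})" by auto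
  also have "\<dots> \<in> sets (PiM A (\<lambda>_. count_space UNIV))"
    by (rule sets.finite_UN)
      (use fin single in \<open>auto simp: space_PiM elim: rev_finite_subset\<close>)
  finally show "?S \<in> sets (PiM A (\<lambda>_. count_space UNIV))" .
qed

text \<open>By \<open>dep\<close>, \<open>F\<close> is a function of the indices before time
  \<open>k\<close>. It therefore takes finitely many values and is independent of
  \<open>I k\<close>, so the expectation of the product factors and the indicator contributes the
  uniform probability. This replaces conditioning on the past.\<close>

lemma
  fixes I :: "nat \<Rightarrow> 'w \<Rightarrow> 'b::finite" and F :: "(nat \<Rightarrow> 'b) \<Rightarrow> real"
  assumes "prob_space M" and iid: "iid_uniform_indices M I"
    and dep: "\<And>i j. (\<And>n. n < k \<Longrightarrow> i n = j n) \<Longrightarrow> F i = F j"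
  shows integrable_of_indices: "integrable M (\<lambda>\<omega>. F (\<lambda>n. I n \<omega>))"
    and expectation_last_index:
      "prob_space.expectation M (\<lambda>\<omega>. indicator {i} (I k \<omega>) * F (\<lambda>n. I n \<omega>))
        = prob_space.expectation M (\<lambda>\<omega>. F (\<lambda>n. I n \<omega>)) / CARD('b)"
proof -
  interpret prob_space M by fact
  have indep: "indep_vars (\<lambda>_. count_space UNIV) I UNIV"
    and unif: "\<And>k. distr M (count_space UNIV) (I k) = uniform_count_measure UNIV"
    using iid by (auto simp: iid_uniform_indices_def)
  have meas: "I k \<in> measurable M (count_space UNIV)" for k
    using indep by (auto simp: indep_vars_def)
  let ?P = "PiM {..<k} (\<lambda>_. count_space (UNIV :: 'b set))"
  let ?Q = "PiM {k} (\<lambda>_. count_space (UNIV :: 'b set))"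
  have "indep_var ?Q (\<lambda>\<omega>. restrict (\<lambda>n. I n \<omega>) {k}) ?P (\<lambda>\<omega>. restrict (\<lambda>n. I n \<omega>) {..<k})"
    by (rule indep_var_restrict[OF indep]) auto
  moreover have "(\<lambda>f. indicator {i} (f k) :: real) \<in> borel_measurable ?Q"
    by (rule measurable_PiM_count_space_finite) auto
  moreover have F: "F \<in> borel_measurable ?P"
    by (rule measurable_PiM_count_space_finite) auto
  ultimately have "indep_var borel ((\<lambda>f. indicator {i} (f k) :: real) \<circ> (\<lambda>\<omega>. restrict (\<lambda>n. I n \<omega>) {k}))
      borel (F \<circ> (\<lambda>\<omega>. restrict (\<lambda>n. I n \<omega>) {..<k}))"
    by (rule indep_var_compose)
  moreover have Feq: "F \<circ> (\<lambda>\<omega>. restrict (\<lambda>n. I n \<omega>) {..<k}) = (\<lambda>\<omega>. F (\<lambda>n. I n \<omega>))"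
    by (auto simp: fun_eq_iff intro!: dep)
  ultimately have ind: "indep_var borel (\<lambda>\<omega>. indicator {i} (I k \<omega>) :: real) borel (\<lambda>\<omega>. F (\<lambda>n. I n \<omega>))"
    by (simp add: o_def)
  have "(\<lambda>\<omega>. restrict (\<lambda>n. I n \<omega>) {..<k}) \<in> measurable M ?P"
    by (intro measurable_restrict meas)
  then have Fm: "(\<lambda>\<omega>. F (\<lambda>n. I n \<omega>)) \<in> borel_measurable M"
    unfolding Feq[symmetric] using F by (rule measurable_comp)
  have "finite (F ` PiE {..<k} (\<lambda>_. UNIV))"
    by (intro finite_imageI finite_PiE) auto
  then obtain B where B: "\<And>f. f \<in> PiE {..<k} (\<lambda>_. UNIV) \<Longrightarrow> \<bar>F f\<bar> \<le> B"
    using finite_imp_bounded[of "F ` PiE {..<k} (\<lambda>_. UNIV)"] by (auto simp: bounded_iff)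
  have "\<bar>F f\<bar> \<le> B" for f
    using B[of "restrict f {..<k}"] dep[of "restrict f {..<k}" f] by simp
  then show int: "integrable M (\<lambda>\<omega>. F (\<lambda>n. I n \<omega>))"
    by (intro integrable_const_bound[of _ B] Fm) auto
  have ind_meas: "(\<lambda>\<omega>. indicator {i} (I k \<omega>) :: real) \<in> borel_measurable M"
    by (rule measurable_compose[OF meas]) simp
  have int': "integrable M (\<lambda>\<omega>. indicator {i} (I k \<omega>) :: real)"
    by (intro integrable_const_bound[of _ 1] ind_meas) (auto simp: indicator_def)
  have "expectation (\<lambda>\<omega>. indicator {i} (I k \<omega>) :: real)
      = integral\<^sup>L (distr M (count_space UNIV) (I k)) (indicator {i})"
    by (subst integral_distr[OF meas]) auto
  also have "\<dots> = 1 / CARD('b)"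
    unfolding unif by (simp add: measure_uniform_count_measure)
  finally have "expectation (\<lambda>\<omega>. indicator {i} (I k \<omega>) :: real) = 1 / CARD('b)" .
  then show "expectation (\<lambda>\<omega>. indicator {i} (I k \<omega>) * F (\<lambda>n. I n \<omega>))
      = expectation (\<lambda>\<omega>. F (\<lambda>n. I n \<omega>)) / CARD('b)"
    using indep_var_lebesgue_integral[OF ind int' int] by simp
qed

subsection \<open>The minimum-norm solution\<close>

lemma bounded_linear_system_op:
  fixes K :: "'x::real_inner \<Rightarrow> 'y::real_inner" and V :: "real ^ 'b::finite ^ 'd::finite"
  assumes "bounded_linear K"
  shows "bounded_linear (system_op K V)"
proof -
  have "bounded_linear (\<lambda>x::'x ^ 'b. K (x $ i))" for i
    using bounded_linear_compose[OF assms bounded_linear_vec_nth] .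
  then show ?thesis
    unfolding system_op_def
    by (intro bounded_linear_vec_lambda bounded_linear_sum bounded_linear_const_scaleR)
qed

text \<open>Existence comes from projecting \<open>x0\<close> onto the closed affine solution set
  and uniqueness from Pythagoras, so the \<open>THE\<close> in \<open>min_norm_solution\<close>
  denotes a solution. Orthogonality to the kernel later places the initial error in the closure of
  \<open>range KK\<close>.\<close>

lemma
  fixes K :: "'x::{real_inner, complete_space} \<Rightarrow> 'y::real_inner"
    and V :: "real ^ 'b::finite ^ 'd::finite"
  assumes K: "bounded_linear K" and y: "y \<in> range (system_op K V)"
  shows system_op_min_norm_solution: "system_op K V (min_norm_solution K V y x0) = y" (is ?sol)
    and min_norm_solution_orthogonal:
      "\<And>n. system_op K V n = 0 \<Longrightarrow> (x0 - min_norm_solution K V y x0) \<bullet> n = 0"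
proof -
  interpret A: bounded_linear "system_op K V"
    by (rule bounded_linear_system_op[OF K])
  define S where "S = {z. system_op K V z = y}"
  have "closed S"
    unfolding S_def
    by (intro closed_Collect_eq continuous_on_const linear_continuous_on A.bounded_linear_axioms)
  moreover have "convex S"
    unfolding S_def convex_def
    by (auto simp: A.add A.scaleR scaleR_left_distrib[symmetric])
  moreover have "S \<noteq> {}" using y unfolding S_def by auto
  ultimately obtain p where p: "p \<in> S" "\<And>z. z \<in> S \<Longrightarrow> norm (p - x0) \<le> norm (z - x0)"
    using exists_closest_point by blast
  have orth: "(p - x0) \<bullet> n = 0" if "system_op K V n = 0" for n
    using p that by (intro closest_point_orthogonal p(2)) (auto simp: S_def A.add A.scaleR)
  have "min_norm_solution K V y x0 = p"
    unfolding min_norm_solution_def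
  proof (rule the_equality)
    show "is_min_norm_solution K V y x0 p"
      using p by (auto simp: is_min_norm_solution_def S_def)
    fix q assume q: "is_min_norm_solution K V y x0 q"
    then have "system_op K V (q - p) = 0"
      using p(1) by (auto simp: is_min_norm_solution_def S_def A.diff)
    then have "(p - x0) \<bullet> (q - p) = 0" by (rule orth)
    then have "(norm ((p - x0) + (q - p)))\<^sup>2 = (norm (p - x0))\<^sup>2 + (norm (q - p))\<^sup>2"
      using norm_add_Pythagorean[of "p - x0" "q - p"] by (simp add: orthogonal_def)
    moreover have "norm (q - x0) \<le> norm (p - x0)"
      using q p(1) by (auto simp: is_min_norm_solution_def S_def)
    then have "(norm (q - x0))\<^sup>2 \<le> (norm (p - x0))\<^sup>2"
      by (intro power_mono) auto
    ultimately show "q = p" by simp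
  qed
  then show ?sol "\<And>n. system_op K V n = 0 \<Longrightarrow> (x0 - min_norm_solution K V y x0) \<bullet> n = 0"
    using p(1) orth by (auto simp: S_def inner_diff_left)
qed

subsection \<open>The iteration\<close>

text \<open>The iterate at time \<open>k\<close> sees only the indices before \<open>k\<close>,
  which is the dependence condition required for averaging over index \<open>k\<close>.\<close>

lemma rbcd_cong:
  assumes "\<And>n. n < k \<Longrightarrow> i n = j n"
  shows "rbcd K V \<gamma> y x0 i k = rbcd K V \<gamma> y x0 j k"
  using assms by (induction k) (auto simp: Let_def)

locale rbcd_problem =
  fixes K :: "'x::{real_inner, complete_space} \<Rightarrow> 'y::{real_inner, complete_space}"
    and V :: "real ^ 'b::finite ^ 'd::finite"
    and \<gamma> :: real
  assumes bounded_linear_K: "bounded_linear K"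
    and step_pos: "0 < \<gamma>"
    and step_less: "\<gamma> * (max_col_sq V * (onorm K)\<^sup>2) < 2"
begin

abbreviation A :: "'x ^ 'b \<Rightarrow> 'y ^ 'd" where
  "A \<equiv> system_op K V"

definition block_adj :: "'b \<Rightarrow> 'y ^ 'd \<Rightarrow> 'x" where
  "block_adj i u = (\<Sum>l\<in>UNIV. (V $ l $ i) *\<^sub>R adjoint K (u $ l))"

text \<open>The block index is an argument, so that the update can be averaged over it with the
  iterate held fixed.\<close>

definition step :: "'y ^ 'd \<Rightarrow> 'b \<Rightarrow> 'x ^ 'b \<Rightarrow> 'x ^ 'b" where
  "step y i x = x - axis i (\<gamma> *\<^sub>R block_adj i (A x - y))"

text \<open>A common bound for the squared norms of all block operators; the step size condition
  reads \<open>\<gamma> * L < 2\<close>.\<close>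

definition L :: real where
  "L = max_col_sq V * (onorm K)\<^sup>2"

definition c :: real where
  "c = \<gamma> / (2 - \<gamma> * L)"

definition lyapunov :: "'y ^ 'd \<Rightarrow> 'x ^ 'b \<Rightarrow> real" where
  "lyapunov y x = (norm x)\<^sup>2 + c * (norm (A x - y))\<^sup>2"

text \<open>The normal operator of \<open>K\<close> acting inside each block. It does not involve
  \<open>V\<close>, which only mixes blocks; this is why it commutes with the updates for zero
  data.\<close>

definition KK :: "'x ^ 'b \<Rightarrow> 'x ^ 'b" where
  "KK x = (\<chi> i. adjoint K (K (x $ i)))"

sublocale A: bounded_linear A
  by (rule bounded_linear_system_op[OF bounded_linear_K])

sublocale K: bounded_linear K
  by (rule bounded_linear_K)

sublocale adj: bounded_linear "adjoint K"
  by (rule bounded_linear_adjoint[OF bounded_linear_K])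

lemma K_inner: "K x \<bullet> y = x \<bullet> adjoint K y"
  by (rule adjoint_inner[OF bounded_linear_K])

lemma c_pos: "0 < c"
  using step_pos step_less by (simp add: c_def L_def)

lemma block_op_inner: "block_op K V i z \<bullet> u = z \<bullet> block_adj i u"
  by (simp add: block_op_def block_adj_def inner_vec_def inner_sum_right K_inner)

lemma adjoint_block_op: "adjoint (block_op K V i) = block_adj i"
  by (rule adjoint_unique) (simp add: block_op_inner)

lemma block_adj_add: "block_adj i (u + v) = block_adj i u + block_adj i v"
  by (simp add: block_adj_def adj.add scaleR_right_distrib sum.distrib)

lemma block_adj_0: "block_adj i 0 = 0"
  by (simp add: block_adj_def adj.zero)

lemma system_op_axis: "A (axis i z) = block_op K V i z"
proof -
  have "(\<Sum>j\<in>UNIV. (V $ l $ j) *\<^sub>R K (axis i z $ j))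
      = (\<Sum>j\<in>UNIV. if j = i then (V $ l $ i) *\<^sub>R K z else 0)" for l
    by (intro sum.cong) (auto simp: axis_def K.zero)
  then show ?thesis
    by (simp add: system_op_def block_op_def vec_eq_iff)
qed

lemma sum_inner_block_adj: "(\<Sum>i\<in>UNIV. x $ i \<bullet> block_adj i r) = A x \<bullet> r"
proof -
  have "A x = (\<Sum>i\<in>UNIV. block_op K V i (x $ i))"
    by (simp add: system_op_def block_op_def vec_eq_iff)
  then show ?thesis
    by (simp add: inner_sum_left block_op_inner)
qed

lemma norm_block_op_le: "(norm (block_op K V i z))\<^sup>2 \<le> L * (norm z)\<^sup>2"
proof -
  have "(norm (block_op K V i z))\<^sup>2 = (\<Sum>l\<in>UNIV. (V $ l $ i)\<^sup>2) * (norm (K z))\<^sup>2"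
    unfolding power2_norm_eq_inner
    by (simp add: block_op_def inner_vec_def sum_distrib_right power2_eq_square mult.assoc)
  also have "(\<Sum>l\<in>UNIV. (V $ l $ i)\<^sup>2) = (norm (column i V))\<^sup>2"
    unfolding power2_norm_eq_inner
    by (simp add: column_def inner_vec_def power2_eq_square)
  also have "\<dots> * (norm (K z))\<^sup>2 \<le> max_col_sq V * (onorm K * norm z)\<^sup>2"
  proof (rule mult_mono)
    show le: "(norm (column i V))\<^sup>2 \<le> max_col_sq V"
      by (auto simp: max_col_sq_def)
    show "0 \<le> max_col_sq V" by (rule order_trans[OF _ le]) simp
    show "(norm (K z))\<^sup>2 \<le> (onorm K * norm z)\<^sup>2"
      by (intro power_mono onorm bounded_linear_K norm_ge_zero)
  qed simp
  finally show ?thesis by (simp add: L_def power_mult_distrib mult.assoc)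
qed

section \<open>Effect of one update on the Lyapunov function\<close>

lemma rbcd_Suc: "rbcd K V \<gamma> y x0 idx (Suc k) = step y (idx k) (rbcd K V \<gamma> y x0 idx k)"
  by (auto simp: Let_def step_def vec_eq_iff axis_def adjoint_block_op)

text \<open>Expand the square: adjointness turns the cross term into the squared norm of the block
  gradient \<open>g\<close>, and \<open>L\<close> bounds the quadratic term. Since
  \<open>\<gamma> * L < 2\<close>, the residual never increases.\<close>

lemma norm_residual_step:
  "(norm (A (step y i x) - y))\<^sup>2
    \<le> (norm (A x - y))\<^sup>2 - \<gamma> * (2 - \<gamma> * L) * (norm (block_adj i (A x - y)))\<^sup>2"
proof -
  define r where "r = A x - y"
  define g where "g = block_adj i r"
  have "A (axis i (\<gamma> *\<^sub>R g)) = \<gamma> *\<^sub>R block_op K V i g"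
    by (simp add: system_op_axis block_op_def K.scaleR vec_eq_iff)
  then have "A (step y i x) - y = r - \<gamma> *\<^sub>R block_op K V i g"
    by (simp add: step_def A.diff r_def g_def)
  then have "(norm (A (step y i x) - y))\<^sup>2 = (norm (r - \<gamma> *\<^sub>R block_op K V i g))\<^sup>2"
    by simp
  also have "\<dots> = (norm r)\<^sup>2 - 2 * \<gamma> * (block_op K V i g \<bullet> r) + \<gamma>\<^sup>2 * (norm (block_op K V i g))\<^sup>2"
    unfolding power2_norm_eq_inner
    by (simp add: inner_diff_left inner_diff_right inner_commute power2_eq_square algebra_simps)
  also have "block_op K V i g \<bullet> r = (norm g)\<^sup>2"
    by (simp add: block_op_inner g_def power2_norm_eq_inner)
  also have "(norm r)\<^sup>2 - 2 * \<gamma> * (norm g)\<^sup>2 + \<gamma>\<^sup>2 * (norm (block_op K V i g))\<^sup>2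
      \<le> (norm r)\<^sup>2 - 2 * \<gamma> * (norm g)\<^sup>2 + \<gamma>\<^sup>2 * (L * (norm g)\<^sup>2)"
    by (intro add_left_mono mult_left_mono norm_block_op_le) simp
  finally show ?thesis
    by (simp add: r_def g_def algebra_simps power2_eq_square)
qed

lemma norm_step:
  "(norm (step y i x))\<^sup>2 = (norm x)\<^sup>2 - 2 * \<gamma> * (x $ i \<bullet> block_adj i (A x - y))
    + \<gamma>\<^sup>2 * (norm (block_adj i (A x - y)))\<^sup>2"
  unfolding step_def power2_norm_eq_inner inner_diff_left inner_diff_right inner_axis
    inner_commute[of "axis i _"]
  by (simp add: axis_def power2_eq_square algebra_simps)

text \<open>The weight \<^term>\<open>c\<close> is such that the decrease of the residual absorbs the quadratic
  term in the expansion of the squared error.\<close>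

lemma lyapunov_step_le:
  "lyapunov y (step y i x) \<le> lyapunov y x - 2 * \<gamma> * (x $ i \<bullet> block_adj i (A x - y))"
proof -
  let ?r = "A x - y"
  have "c * (norm (A (step y i x) - y))\<^sup>2
      \<le> c * ((norm ?r)\<^sup>2 - \<gamma> * (2 - \<gamma> * L) * (norm (block_adj i ?r))\<^sup>2)"
    by (intro mult_left_mono norm_residual_step less_imp_le c_pos)
  also have "\<dots> = c * (norm ?r)\<^sup>2 - \<gamma> * (c * (2 - \<gamma> * L)) * (norm (block_adj i ?r))\<^sup>2"
    by (simp add: algebra_simps)
  also have "c * (2 - \<gamma> * L) = \<gamma>"
    using step_less by (simp add: c_def L_def)
  finally show ?thesis
    unfolding lyapunov_def norm_step power2_eq_square[of \<gamma>] by linarith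
qed

text \<open>The sum over \<open>i\<close> is \<open>CARD('b)\<close> times the mean over a uniform
  index. Summation assembles the block inner products into the single one of \<open>A x\<close> with
  the residual.\<close>

lemma sum_lyapunov_step_le:
  "(\<Sum>i\<in>UNIV. lyapunov y (step y i x))
    \<le> CARD('b) * lyapunov y x + \<gamma> * ((norm y)\<^sup>2 - (norm (A x - y))\<^sup>2)"
proof -
  let ?r = "A x - y"
  have "(\<Sum>i\<in>UNIV. lyapunov y (step y i x))
      \<le> (\<Sum>i\<in>UNIV. lyapunov y x - 2 * \<gamma> * (x $ i \<bullet> block_adj i ?r))"
    by (intro sum_mono lyapunov_step_le)
  also have "\<dots> = CARD('b) * lyapunov y x - \<gamma> * (2 * (A x \<bullet> ?r))"
    by (simp add: sum_subtractf sum_distrib_left[symmetric] sum_inner_block_adj)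
  \<comment> \<open>The polarization identity; the term with the norm of \<open>A x\<close> has a
    favourable sign and is dropped next.\<close>
  also have "2 * (A x \<bullet> ?r) = (norm ?r)\<^sup>2 - (norm y)\<^sup>2 + (norm (A x))\<^sup>2"
    by (simp add: power2_norm_eq_inner inner_diff_left inner_diff_right inner_commute)
  also have "CARD('b) * lyapunov y x - \<gamma> * \<dots>
      \<le> CARD('b) * lyapunov y x + \<gamma> * ((norm y)\<^sup>2 - (norm ?r)\<^sup>2)"
    using step_pos by (simp add: algebra_simps)
  finally show ?thesis .
qed

lemma norm_le_lyapunov: "(norm x)\<^sup>2 \<le> lyapunov y x"
  using c_pos by (simp add: lyapunov_def)

lemma lyapunov_0_le: "lyapunov 0 x \<le> (1 + c * (onorm A)\<^sup>2) * (norm x)\<^sup>2"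
proof -
  have "(norm (A x))\<^sup>2 \<le> (onorm A * norm x)\<^sup>2"
    by (intro power_mono onorm A.bounded_linear_axioms norm_ge_zero)
  then have "c * (norm (A x))\<^sup>2 \<le> c * (onorm A * norm x)\<^sup>2"
    using c_pos by simp
  then show ?thesis
    by (simp add: lyapunov_def algebra_simps power_mult_distrib)
qed

section \<open>Superposition and fixed points\<close>

lemma step_add: "step (y + z) i (u + v) = step y i u + step z i v"
proof -
  have eq: "A (u + v) - (y + z) = (A u - y) + (A v - z)" by (simp add: A.add)
  show ?thesis
    unfolding step_def eq by (simp add: block_adj_add vec_eq_iff axis_def scaleR_right_distrib)
qed

text \<open>For a fixed index sequence the iteration is additive jointly in data and starting point.
  This separates the data noise from the initial error.\<close>

lemma rbcd_add:
  "rbcd K V \<gamma> (y + z) (u + v) idx k = rbcd K V \<gamma> y u idx k + rbcd K V \<gamma> z v idx k"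
  by (induction k) (simp_all add: rbcd_Suc step_add del: rbcd.simps(2))

lemma rbcd_fixed_point: "rbcd K V \<gamma> (A x) x idx k = x"
  by (induction k)
    (simp_all add: rbcd_Suc step_def block_adj_0 axis_eq_0_iff del: rbcd.simps(2))

section \<open>The blockwise normal operator\<close>

lemma bounded_linear_KK: "bounded_linear KK"
  unfolding KK_def
  by (intro bounded_linear_vec_lambda bounded_linear_compose[OF adj.bounded_linear_axioms]
      bounded_linear_compose[OF bounded_linear_K] bounded_linear_vec_nth)

lemma KK_self_adjoint: "KK u \<bullet> v = u \<bullet> KK v"
  by (simp add: KK_def inner_vec_def K_inner[symmetric] inner_commute[of "adjoint K _"])
    (simp add: inner_commute)

lemma KK_eq_0D:
  assumes "KK u = 0"
  shows "A u = 0"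
proof -
  have "K (u $ i) \<bullet> K (u $ i) = 0" for i
    using assms by (simp add: K_inner KK_def vec_eq_iff)
  then show ?thesis by (simp add: system_op_def vec_eq_iff)
qed

text \<open>Applying \<open>A\<close> turns \<open>KK\<close> into the composition of
  \<open>K\<close> after \<open>adjoint K\<close> in each component, and \<open>block_adj\<close>
  turns that back into \<open>adjoint K\<close> after \<open>K\<close>; the scalar entries of
  \<open>V\<close> pass through both.\<close>

lemma step_KK: "step 0 i (KK u) = KK (step 0 i u)"
proof -
  have "A (KK u) $ l = K (adjoint K (A u $ l))" for l
    by (simp add: system_op_def KK_def K.sum K.scaleR adj.sum adj.scaleR)
  then have "block_adj i (A (KK u)) = adjoint K (K (block_adj i (A u)))"
    by (simp add: block_adj_def K.sum K.scaleR adj.sum adj.scaleR)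
  then show ?thesis
    by (simp add: step_def vec_eq_iff KK_def axis_def K.diff adj.diff K.scaleR adj.scaleR
        K.zero adj.zero)
qed

lemma rbcd_KK: "rbcd K V \<gamma> 0 (KK u) idx k = KK (rbcd K V \<gamma> 0 u idx k)"
  by (induction k) (simp_all add: rbcd_Suc step_KK del: rbcd.simps(2))

text \<open>Full column rank gives a left inverse \<open>W\<close> of \<open>V\<close>, which
  recovers every \<open>K (u $ i)\<close> from \<open>A u\<close>. Hence \<open>KK\<close> factors
  as a bounded operator after \<open>A\<close>.\<close>

lemma norm_KK_le_residual:
  assumes "rank V = CARD('b)"
  obtains C where "\<And>u. (norm (KK u))\<^sup>2 \<le> C * (norm (A u))\<^sup>2"
proof -
  obtain W :: "real ^ 'd ^ 'b" where W: "W ** V = mat 1"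
    using assms full_rank_injective matrix_left_invertible_injective by metis
  let ?B = "system_op (adjoint K) W"
  have W': "(\<Sum>l\<in>UNIV. W $ i $ l * V $ l $ j) = (if i = j then 1 else 0)" for i j
    using W by (simp add: matrix_matrix_mult_def mat_def vec_eq_iff)
  have KK_eq: "KK u = ?B (A u)" for u
  proof -
    have "?B (A u) $ i = adjoint K (K (u $ i))" for i
    proof -
      have "?B (A u) $ i = (\<Sum>l\<in>UNIV. \<Sum>j\<in>UNIV. (W $ i $ l * V $ l $ j) *\<^sub>R adjoint K (K (u $ j)))"
        by (simp add: system_op_def adj.sum adj.scaleR scaleR_sum_right)
      also have "\<dots> = (\<Sum>j\<in>UNIV. (\<Sum>l\<in>UNIV. W $ i $ l * V $ l $ j) *\<^sub>R adjoint K (K (u $ j)))"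
        by (subst sum.swap) (simp add: scaleR_sum_left)
      also have "\<dots> = (\<Sum>j\<in>UNIV. if i = j then adjoint K (K (u $ j)) else 0)"
        unfolding W' by (intro sum.cong) auto
      finally show ?thesis by simp
    qed
    then show ?thesis by (simp add: KK_def vec_eq_iff)
  qed
  have B: "bounded_linear ?B"
    by (rule bounded_linear_system_op[OF adj.bounded_linear_axioms])
  have "(norm (KK u))\<^sup>2 \<le> (onorm ?B)\<^sup>2 * (norm (A u))\<^sup>2" for u
    unfolding KK_eq power_mult_distrib[symmetric]
    by (intro power_mono onorm B norm_ge_zero)
  then show ?thesis by (rule that)
qed

end

section \<open>Mean-square estimates for random indices\<close>

locale rbcd_random = rbcd_problem K V \<gamma> + prob_space M
  for K :: "'x::{real_inner, complete_space} \<Rightarrow> 'y::{real_inner, complete_space}"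
    and V :: "real ^ 'b::finite ^ 'd::finite" and \<gamma> :: real and M :: "'w measure" +
  fixes I :: "nat \<Rightarrow> 'w \<Rightarrow> 'b"
  assumes iid: "iid_uniform_indices M I"
begin

abbreviation X :: "'y ^ 'd \<Rightarrow> 'x ^ 'b \<Rightarrow> nat \<Rightarrow> 'w \<Rightarrow> 'x ^ 'b" where
  "X y a k \<omega> \<equiv> rbcd K V \<gamma> y a (\<lambda>n. I n \<omega>) k"

text \<open>This holds for an arbitrary real function \<open>g\<close>, because the iterate takes
  only finitely many values.\<close>

lemma integrable_X: "integrable M (\<lambda>\<omega>. g (X y a k \<omega>) :: real)"
  by (rule integrable_of_indices[OF prob_space_axioms iid, of k]) (metis rbcd_cong)

text \<open>Splitting according to the value of the last index, which is independent of the current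
  iterate, gives the tower property without conditional expectations.\<close>

lemma expectation_X_Suc:
  fixes g :: "'x ^ 'b \<Rightarrow> real"
  shows "expectation (\<lambda>\<omega>. g (X y a (Suc k) \<omega>))
    = expectation (\<lambda>\<omega>. \<Sum>i\<in>UNIV. g (step y i (X y a k \<omega>))) / CARD('b)"
proof -
  have last: "expectation (\<lambda>\<omega>. indicator {i} (I k \<omega>) * g (step y i (X y a k \<omega>)))
      = expectation (\<lambda>\<omega>. g (step y i (X y a k \<omega>))) / CARD('b)" for i
    by (rule expectation_last_index[OF prob_space_axioms iid]) (metis rbcd_cong)
  have int: "integrable M (\<lambda>\<omega>. indicator {i} (I k \<omega>) * g (step y i (X y a k \<omega>)))" for i
    \<comment> \<open>The integrand also contains index \<open>k\<close> itself, so the dependence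
      bound is \<open>Suc k\<close>.\<close>
    by (rule integrable_of_indices[OF prob_space_axioms iid, of "Suc k"
          "\<lambda>f. indicator {i} (f k) * g (step y i (rbcd K V \<gamma> y a f k))"])
      (metis less_Suc_eq rbcd_cong)
  have "g (X y a (Suc k) \<omega>) = (\<Sum>i\<in>UNIV. indicator {i} (I k \<omega>) * g (step y i (X y a k \<omega>)))" for \<omega>
  proof -
    have "(\<Sum>i\<in>UNIV. indicator {i} (I k \<omega>) * g (step y i (X y a k \<omega>)))
        = (\<Sum>i\<in>UNIV. if i = I k \<omega> then g (step y (I k \<omega>) (X y a k \<omega>)) else 0)"
      by (intro sum.cong) auto
    then show ?thesis by (simp add: rbcd_Suc del: rbcd.simps(2))
  qed
  then have "expectation (\<lambda>\<omega>. g (X y a (Suc k) \<omega>))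
      = (\<Sum>i\<in>UNIV. expectation (\<lambda>\<omega>. indicator {i} (I k \<omega>) * g (step y i (X y a k \<omega>))))"
    by (simp only: Bochner_Integration.integral_sum[OF int])
  also have "\<dots> = (\<Sum>i\<in>UNIV. expectation (\<lambda>\<omega>. g (step y i (X y a k \<omega>)))) / CARD('b)"
    by (simp add: last sum_divide_distrib)
  also have "(\<Sum>i\<in>UNIV. expectation (\<lambda>\<omega>. g (step y i (X y a k \<omega>))))
      = expectation (\<lambda>\<omega>. \<Sum>i\<in>UNIV. g (step y i (X y a k \<omega>)))"
    by (rule Bochner_Integration.integral_sum[symmetric]) (rule integrable_X)
  finally show ?thesis .
qed

lemma expectation_lyapunov_Suc:
  "expectation (\<lambda>\<omega>. lyapunov y (X y a (Suc k) \<omega>))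
    \<le> expectation (\<lambda>\<omega>. lyapunov y (X y a k \<omega>))
      + \<gamma> / CARD('b) * ((norm y)\<^sup>2 - expectation (\<lambda>\<omega>. (norm (A (X y a k \<omega>) - y))\<^sup>2))"
proof -
  have "expectation (\<lambda>\<omega>. \<Sum>i\<in>UNIV. lyapunov y (step y i (X y a k \<omega>)))
      \<le> expectation (\<lambda>\<omega>. CARD('b) * lyapunov y (X y a k \<omega>)
          + \<gamma> * ((norm y)\<^sup>2 - (norm (A (X y a k \<omega>) - y))\<^sup>2))"
    by (intro integral_mono sum_lyapunov_step_le integrable_X)
  also have "\<dots> = CARD('b) * expectation (\<lambda>\<omega>. lyapunov y (X y a k \<omega>))
      + \<gamma> * ((norm y)\<^sup>2 - expectation (\<lambda>\<omega>. (norm (A (X y a k \<omega>) - y))\<^sup>2))"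
    using integrable_X[of "lyapunov y" y a k] integrable_X[of "\<lambda>x. (norm (A x - y))\<^sup>2" y a k]
    by (simp add: prob_space)
  finally show ?thesis
    unfolding expectation_X_Suc by (simp add: field_simps)
qed

text \<open>The one-step estimate telescoped. Dropping the residual sum bounds the growth of the
  iterates; dropping the Lyapunov term for \<open>y = 0\<close> makes the residuals
  summable.\<close>

lemma expectation_lyapunov_sum_le:
  "expectation (\<lambda>\<omega>. lyapunov y (X y a k \<omega>))
      + \<gamma> / CARD('b) * (\<Sum>n<k. expectation (\<lambda>\<omega>. (norm (A (X y a n \<omega>) - y))\<^sup>2))
    \<le> lyapunov y a + \<gamma> / CARD('b) * real k * (norm y)\<^sup>2"
proof (induction k)
  case 0
  then show ?case by (simp add: prob_space)
next
  case (Suc k)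
  then show ?case
    using expectation_lyapunov_Suc[of y a k]
    by (simp add: algebra_simps add_divide_distrib del: rbcd.simps(2))
qed

lemma expectation_norm_le:
  "expectation (\<lambda>\<omega>. (norm (X y a k \<omega>))\<^sup>2)
    \<le> lyapunov y a + \<gamma> / CARD('b) * real k * (norm y)\<^sup>2"
proof -
  have "expectation (\<lambda>\<omega>. (norm (X y a k \<omega>))\<^sup>2) \<le> expectation (\<lambda>\<omega>. lyapunov y (X y a k \<omega>))"
    by (intro integral_mono integrable_X norm_le_lyapunov)
  moreover have "0 \<le> \<gamma> / CARD('b) * (\<Sum>n<k. expectation (\<lambda>\<omega>. (norm (A (X y a n \<omega>) - y))\<^sup>2))"
    using step_pos by (intro mult_nonneg_nonneg sum_nonneg Bochner_Integration.integral_nonneg) auto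
  ultimately show ?thesis
    using expectation_lyapunov_sum_le[of y a k] by linarith
qed

lemma expectation_residual_tendsto_0:
  "(\<lambda>k. expectation (\<lambda>\<omega>. (norm (A (X 0 a k \<omega>)))\<^sup>2)) \<longlonglongrightarrow> 0"
proof (intro summable_LIMSEQ_zero bounded_imp_summable)
  show "0 \<le> expectation (\<lambda>\<omega>. (norm (A (X 0 a k \<omega>)))\<^sup>2)" for k
    by (intro Bochner_Integration.integral_nonneg) auto
  fix k
  have "0 \<le> expectation (\<lambda>\<omega>. lyapunov 0 (X 0 a (Suc k) \<omega>))"
    using c_pos by (intro Bochner_Integration.integral_nonneg) (auto simp: lyapunov_def)
  then have "\<gamma> / CARD('b) * (\<Sum>n<Suc k. expectation (\<lambda>\<omega>. (norm (A (X 0 a n \<omega>)))\<^sup>2)) \<le> lyapunov 0 a"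
    using expectation_lyapunov_sum_le[of 0 a "Suc k"] by (simp del: rbcd.simps(2) sum.lessThan_Suc)
  then show "(\<Sum>n\<le>k. expectation (\<lambda>\<omega>. (norm (A (X 0 a n \<omega>)))\<^sup>2)) \<le> lyapunov 0 a * CARD('b) / \<gamma>"
    using step_pos by (simp add: field_simps lessThan_Suc_atMost del: sum.lessThan_Suc)
qed

text \<open>Split \<open>a\<close> as \<open>a - KK w\<close> plus \<open>KK w\<close>. The first
  part contributes a mean-square error that is small uniformly in \<open>k\<close> when
  \<open>KK w\<close> is near \<open>a\<close>. The second evolves as \<open>KK\<close> of the
  iteration from \<open>w\<close>, which is bounded by residuals tending to 0.\<close>

lemma expectation_homogeneous_tendsto_0:
  assumes rank: "rank V = CARD('b)" and orth: "\<And>n. A n = 0 \<Longrightarrow> a \<bullet> n = 0"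
  shows "(\<lambda>k. expectation (\<lambda>\<omega>. (norm (X 0 a k \<omega>))\<^sup>2)) \<longlonglongrightarrow> 0"
proof -
  obtain C where C: "\<And>u. (norm (KK u))\<^sup>2 \<le> C * (norm (A u))\<^sup>2"
    using norm_KK_le_residual[OF rank] by blast
  define D where "D = 1 + c * (onorm A)\<^sup>2"
  have D: "D > 0" using c_pos by (simp add: D_def add_pos_nonneg)
  have a: "a \<in> closure (range KK)"
    by (rule closure_range_self_adjoint[OF bounded_linear_KK KK_self_adjoint])
      (use orth KK_eq_0D in blast)
  have bound: "expectation (\<lambda>\<omega>. (norm (X 0 a k \<omega>))\<^sup>2)
      \<le> 2 * (D * (norm (a - KK w))\<^sup>2) + 2 * (C * expectation (\<lambda>\<omega>. (norm (A (X 0 w k \<omega>)))\<^sup>2))"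
    for k w
  proof -
    have eq: "X 0 a k \<omega> = X 0 (a - KK w) k \<omega> + KK (X 0 w k \<omega>)" for \<omega>
      using rbcd_add[of 0 0 "a - KK w" "KK w"] by (simp add: rbcd_KK)
    have "(norm (X 0 a k \<omega>))\<^sup>2 \<le> 2 * (norm (X 0 (a - KK w) k \<omega>))\<^sup>2 + 2 * (C * (norm (A (X 0 w k \<omega>)))\<^sup>2)" for \<omega>
      unfolding eq
      using norm_add_square_le[of "X 0 (a - KK w) k \<omega>" "KK (X 0 w k \<omega>)"] C[of "X 0 w k \<omega>"]
      by linarith
    then have "expectation (\<lambda>\<omega>. (norm (X 0 a k \<omega>))\<^sup>2)
        \<le> expectation (\<lambda>\<omega>. 2 * (norm (X 0 (a - KK w) k \<omega>))\<^sup>2 + 2 * (C * (norm (A (X 0 w k \<omega>)))\<^sup>2))"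
      by (intro integral_mono Bochner_Integration.integrable_add integrable_X)
    also have "\<dots> = 2 * expectation (\<lambda>\<omega>. (norm (X 0 (a - KK w) k \<omega>))\<^sup>2)
        + 2 * (C * expectation (\<lambda>\<omega>. (norm (A (X 0 w k \<omega>)))\<^sup>2))"
      by (subst Bochner_Integration.integral_add) (auto intro: integrable_X)
    also have "expectation (\<lambda>\<omega>. (norm (X 0 (a - KK w) k \<omega>))\<^sup>2) \<le> D * (norm (a - KK w))\<^sup>2"
      using expectation_norm_le[of 0 "a - KK w" k] lyapunov_0_le[of "a - KK w"]
      by (simp add: D_def)
    finally show ?thesis by simp
  qed
  show ?thesis
  proof (rule LIMSEQ_I)
    fix e :: real assume "e > 0"
    \<comment> \<open>This radius makes the contribution \<open>2 * (D * ...)\<close> of the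
      approximation error less than \<open>e / 2\<close>.\<close>
    then have "sqrt (e / (4 * D)) > 0" using D by simp
    then obtain w where "dist (KK w) a < sqrt (e / (4 * D))"
      using a unfolding closure_approachable by blast
    then have "(norm (a - KK w))\<^sup>2 < e / (4 * D)"
      using real_less_rsqrt[of "norm (a - KK w)"] real_sqrt_less_iff[of "(norm (a - KK w))\<^sup>2"]
      by (simp add: dist_norm norm_minus_commute)
    then have w: "2 * (D * (norm (a - KK w))\<^sup>2) < e / 2"
      using D by (simp add: field_simps)
    have "(\<lambda>k. 2 * (C * expectation (\<lambda>\<omega>. (norm (A (X 0 w k \<omega>)))\<^sup>2))) \<longlonglongrightarrow> 2 * (C * 0)"
      by (intro tendsto_intros expectation_residual_tendsto_0)
    then have "\<forall>\<^sub>F k in sequentially. 2 * (C * expectation (\<lambda>\<omega>. (norm (A (X 0 w k \<omega>)))\<^sup>2)) < e / 2"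
      by (rule order_tendstoD) (use \<open>e > 0\<close> in simp)
    then obtain N where N: "\<And>k. k \<ge> N \<Longrightarrow> 2 * (C * expectation (\<lambda>\<omega>. (norm (A (X 0 w k \<omega>)))\<^sup>2)) < e / 2"
      unfolding eventually_sequentially by blast
    have nonneg: "0 \<le> expectation (\<lambda>\<omega>. (norm (X 0 a k \<omega>))\<^sup>2)" for k
      by (intro Bochner_Integration.integral_nonneg) auto
    show "\<exists>N. \<forall>k\<ge>N. norm (expectation (\<lambda>\<omega>. (norm (X 0 a k \<omega>))\<^sup>2) - 0) < e"
    proof (intro exI[of _ N] allI impI)
      fix k assume "k \<ge> N"
      then show "norm (expectation (\<lambda>\<omega>. (norm (X 0 a k \<omega>))\<^sup>2) - 0) < e"
        using bound[of k w] N[of k] w nonneg[of k] by simp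
    qed
  qed
qed

end

section \<open>Convergence under the stopping rule\<close>

theorem theorem2p11:
  fixes K :: "'x::{real_inner, complete_space} \<Rightarrow> 'y::{real_inner, complete_space}"
    and V :: "real ^ 'b::finite ^ 'd::finite"
    and x0 :: "'x ^ 'b" and y :: "'y ^ 'd" and ydelta :: "real \<Rightarrow> 'y ^ 'd"
    and \<gamma> :: real and kdelta :: "real \<Rightarrow> nat"
    and M :: "'w measure" and I :: "nat \<Rightarrow> 'w \<Rightarrow> 'b"
  assumes "bounded_linear K"
    and "y \<in> range (system_op K V)"
    and "\<And>\<delta>. \<delta> > 0 \<Longrightarrow> norm (ydelta \<delta> - y) \<le> \<delta>"
    and "prob_space M"
    and "iid_uniform_indices M I"
    and "rank V = CARD('b)"
    and "0 < \<gamma>"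
    and "\<gamma> * (max_col_sq V * (onorm K)\<^sup>2) < 2"
      \<comment> \<open>\<open>\<gamma> < 2 / (v\<^sup>* \<parallel>K\<parallel>\<^sup>2)\<close>, multiplied out since division by zero is 0 here
          and would silently exclude \<open>K = 0\<close>\<close>
    and "filterlim kdelta at_top (at_right 0)"
    and "((\<lambda>\<delta>. \<delta>\<^sup>2 * real (kdelta \<delta>)) \<longlongrightarrow> 0) (at_right 0)"
  shows "((\<lambda>\<delta>. prob_space.expectation M (\<lambda>\<omega>.
            (norm (rbcd K V \<gamma> (ydelta \<delta>) x0 (\<lambda>k. I k \<omega>) (kdelta \<delta>)
                   - min_norm_solution K V y x0))\<^sup>2)) \<longlongrightarrow> 0) (at_right 0)"
proof -
  interpret prob_space M by fact
  interpret rbcd_random K V \<gamma> M I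
    by (intro rbcd_random.intro rbcd_problem.intro rbcd_random_axioms.intro assms)
  define xs where "xs = min_norm_solution K V y x0"
  have sol: "A xs = y"
    unfolding xs_def by (rule system_op_min_norm_solution) fact+
  have orth: "(x0 - xs) \<bullet> n = 0" if "A n = 0" for n
    unfolding xs_def by (rule min_norm_solution_orthogonal) fact+
  define E0 where "E0 k = expectation (\<lambda>\<omega>. (norm (X 0 (x0 - xs) k \<omega>))\<^sup>2)" for k
  have E0: "E0 \<longlonglongrightarrow> 0"
    unfolding E0_def by (rule expectation_homogeneous_tendsto_0[OF assms(6) orth])
  \<comment> \<open>The first term is the initial error. In the second,
    \<open>c * \<delta>\<^sup>2\<close> bounds the Lyapunov value of the noise iteration at its
    start 0, and the rest bounds its growth over \<open>kdelta \<delta>\<close> steps.\<close>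
  define bnd where
    "bnd \<delta> = 2 * E0 (kdelta \<delta>) + 2 * (c * \<delta>\<^sup>2 + \<gamma> / CARD('b) * (\<delta>\<^sup>2 * real (kdelta \<delta>)))" for \<delta>
  have upper: "expectation (\<lambda>\<omega>. (norm (X (ydelta \<delta>) x0 (kdelta \<delta>) \<omega> - xs))\<^sup>2) \<le> bnd \<delta>"
    if "\<delta> > 0" for \<delta>
  proof -
    define \<eta> where "\<eta> = ydelta \<delta> - y"
    define k where "k = kdelta \<delta>"
    have \<eta>: "(norm \<eta>)\<^sup>2 \<le> \<delta>\<^sup>2"
      unfolding \<eta>_def using assms(3)[OF that] by (intro power_mono) auto
    \<comment> \<open>Data split as \<open>y + \<eta>\<close> and start as
      \<open>xs + (x0 - xs)\<close>; the iteration with data \<open>y\<close> started at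
      \<open>xs\<close> stays at \<open>xs\<close> and cancels.\<close>
    have eq: "X (ydelta \<delta>) x0 k \<omega> - xs = X 0 (x0 - xs) k \<omega> + X \<eta> 0 k \<omega>" for \<omega>
      using rbcd_add[of y \<eta> xs "x0 - xs" "\<lambda>n. I n \<omega>" k]
        rbcd_add[of 0 \<eta> "x0 - xs" 0 "\<lambda>n. I n \<omega>" k] rbcd_fixed_point[of xs "\<lambda>n. I n \<omega>" k]
      by (simp add: \<eta>_def sol)
    have "expectation (\<lambda>\<omega>. (norm (X (ydelta \<delta>) x0 k \<omega> - xs))\<^sup>2)
        \<le> expectation (\<lambda>\<omega>. 2 * (norm (X 0 (x0 - xs) k \<omega>))\<^sup>2 + 2 * (norm (X \<eta> 0 k \<omega>))\<^sup>2)"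
      by (intro integral_mono Bochner_Integration.integrable_add integrable_X)
        (simp only: eq norm_add_square_le)
    also have "\<dots> = 2 * E0 k + 2 * expectation (\<lambda>\<omega>. (norm (X \<eta> 0 k \<omega>))\<^sup>2)"
      unfolding E0_def by (subst Bochner_Integration.integral_add) (auto intro: integrable_X)
    also have "expectation (\<lambda>\<omega>. (norm (X \<eta> 0 k \<omega>))\<^sup>2)
        \<le> c * (norm \<eta>)\<^sup>2 + \<gamma> / CARD('b) * real k * (norm \<eta>)\<^sup>2"
      using expectation_norm_le[of \<eta> 0 k] by (simp add: lyapunov_def A.zero)
    also have "\<dots> \<le> c * \<delta>\<^sup>2 + \<gamma> / CARD('b) * real k * \<delta>\<^sup>2"
      using c_pos step_pos \<eta> by (intro add_mono mult_left_mono) auto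
    finally show ?thesis
      by (simp add: bnd_def k_def mult_ac)
  qed
  have "(bnd \<longlongrightarrow> 2 * 0 + 2 * (c * 0\<^sup>2 + \<gamma> / CARD('b) * 0)) (at_right 0)"
    unfolding bnd_def
    by (intro tendsto_intros assms(10) filterlim_compose[OF E0 assms(9)])
  then have bnd: "(bnd \<longlongrightarrow> 0) (at_right 0)" by simp
  have "((\<lambda>\<delta>. expectation (\<lambda>\<omega>. (norm (X (ydelta \<delta>) x0 (kdelta \<delta>) \<omega> - xs))\<^sup>2)) \<longlongrightarrow> 0) (at_right 0)"
  proof (rule tendsto_sandwich[OF _ _ tendsto_const bnd])
    show "\<forall>\<^sub>F \<delta> in at_right 0. 0 \<le> expectation (\<lambda>\<omega>. (norm (X (ydelta \<delta>) x0 (kdelta \<delta>) \<omega> - xs))\<^sup>2)"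
      by (intro always_eventually allI Bochner_Integration.integral_nonneg) auto
    show "\<forall>\<^sub>F \<delta> in at_right 0.
        expectation (\<lambda>\<omega>. (norm (X (ydelta \<delta>) x0 (kdelta \<delta>) \<omega> - xs))\<^sup>2) \<le> bnd \<delta>"
      using eventually_at_right_less[of 0] by eventually_elim (rule upper)
  qed
  then show ?thesis unfolding xs_def .
qed

end
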